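(* The Roe (upwind) scheme for the acoustic equations $$\partial_t\mathbf v+\frac1{\epsilon^2}\nabla p=0,\qquad\partial_tp+c^2\,\nabla\cdot\mathbf v=0$$ in two spatial dimensions is not stationarity preserving.
   Context: Here $\mathbf v=(u,v)$, $q=(u,v,p)$, and $c>0$, $\epsilon>0$ are constants. On a Cartesian grid with constant spacings $\Delta x,\Delta y$ and cells $(i,j)\in\mathbb Z^2$, the (semi-discrete) Roe scheme is $$\partial_tq_{ij}+\frac1{2\Delta x}\Big(J_x(q_{i+1,j}-q_{i-1,j})-D_x(q_{i+1,j}-2q_{ij}+q_{i-1,j})\Big)+\frac1{2\Delta y}\Big(J_y(q_{i,j+1}-q_{i,j-1})-D_y(q_{i,j+1}-2q_{ij}+q_{i,j-1})\Big)=0$$ with $$J_x=\begin{pmatrix}0&0&\epsilon^{-2}\\0&0&0\\c^2&0&0\end{pmatrix},\quad J_y=\begin{pmatrix}0&0&0\\0&0&\epsilon^{-2}\\0&c^2&0\end{pmatrix},\quad D_x=|J_x|=\mathrm{diag}\left(\tfrac c\epsilon,0,\tfrac c\epsilon\right),\quad D_y=|J_y|=\mathrm{diag}\left(0,\tfrac c\epsilon,\tfrac c\epsilon\right),$$ the absolute value being defined on the eigenvalues. A stationary state of the PDE is called trivial if no component of $q$ can be chosen freely as a function of $\mathbf x$. A consistent linear scheme is called stationarity preserving if it possesses nontrivial (numerical) stationary states that discretize all the analytic stationary states of the PDE, which here are given by $\nabla p=0$, $\nabla\cdot\mathbf v=0$. For a linear scheme $\partial_tq_I+\sum_S\alpha_Sq_{I+S}=0$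 a necessary condition for this is that $\det\mathcal E(\mathbf k)=0$ for all $\mathbf k$, where $\mathcal E(\mathbf k)=-\sum_S\mathrm i\,\alpha_S\,t_x^{S_1}t_y^{S_2}$ with $t_x=\exp(\mathrm ik_x\Delta x)$, $t_y=\exp(\mathrm ik_y\Delta y)$. *)

theory Defs
  imports "HOL-Analysis.Analysis"
begin

text \<open>
  Linear systems \<open>\<partial>\<^sub>t q + J\<^sub>x \<partial>\<^sub>x q + J\<^sub>y \<partial>\<^sub>y q = 0\<close> in two space dimensions. Solutions are
  classical: continuously differentiable in space, differentiable in time.
\<close>

definition has_C1_partials ::
  "(real \<times> real \<Rightarrow> real ^ 'n) \<Rightarrow> (real \<times> real \<Rightarrow> real ^ 'n) \<Rightarrow> (real \<times> real \<Rightarrow> real ^ 'n) \<Rightarrow> bool"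
  where
  "has_C1_partials q qx qy \<longleftrightarrow>
     continuous_on UNIV qx \<and> continuous_on UNIV qy \<and>
     (\<forall>z. (q has_derivative (\<lambda>d. fst d *\<^sub>R qx z + snd d *\<^sub>R qy z)) (at z))"

definition pde_solution ::
  "real ^ 'n ^ 'n \<Rightarrow> real ^ 'n ^ 'n \<Rightarrow> (real \<Rightarrow> real \<times> real \<Rightarrow> real ^ 'n) \<Rightarrow> bool"
  where
  "pde_solution Jx Jy q \<longleftrightarrow>
     (\<exists>qt qx qy. \<forall>t.
        (\<forall>z. ((\<lambda>s. q s z) has_vector_derivative qt t z) (at t)) \<and>
        has_C1_partials (q t) (qx t) (qy t) \<and>
        (\<forall>z. qt t z + Jx *v qx t z + Jy *v qy t z = 0))"

definition analytic_stationary_state ::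
  "real ^ 'n ^ 'n \<Rightarrow> real ^ 'n ^ 'n \<Rightarrow> (real \<times> real \<Rightarrow> real ^ 'n) \<Rightarrow> bool"
  where
  "analytic_stationary_state Jx Jy q \<longleftrightarrow> pde_solution Jx Jy (\<lambda>t. q)"


text \<open>
  A semi-discrete scheme \<open>\<partial>\<^sub>t q\<^sub>I + L q I = 0\<close> is given, for all grid spacings, by its spatial
  operator \<open>L\<close> on grid functions.
\<close>

type_synonym 'n grid_fun = "int \<times> int \<Rightarrow> real ^ 'n"

type_synonym 'n scheme = "real \<Rightarrow> real \<Rightarrow> 'n grid_fun \<Rightarrow> 'n grid_fun"

definition grid_point :: "real \<Rightarrow> real \<Rightarrow> int \<times> int \<Rightarrow> real \<times> real" where
  "grid_point dx dy I = (of_int (fst I) * dx, of_int (snd I) * dy)"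

definition linear_scheme :: "('n::finite) scheme \<Rightarrow> bool" where
  "linear_scheme L \<longleftrightarrow>
     (\<forall>dx>0. \<forall>dy>0. \<exists>\<S> \<alpha>. finite \<S> \<and>
        (\<forall>q I. L dx dy q I = (\<Sum>S\<in>\<S>. \<alpha> S *v q (I + S))))"

text \<open>
  Consistency and convergence refer to the uniform refinement \<open>(h dx, h dy)\<close>, \<open>h \<rightarrow> 0\<close>, of the
  grid with spacings \<open>dx\<close> and \<open>dy\<close>.
\<close>

definition consistent_scheme ::
  "real ^ 'n ^ 'n \<Rightarrow> real ^ 'n ^ 'n \<Rightarrow> 'n scheme \<Rightarrow> real \<Rightarrow> real \<Rightarrow> bool"
  where
  "consistent_scheme Jx Jy L dx dy \<longleftrightarrow>
     (\<forall>q qx qy z. has_C1_partials q qx qy \<longrightarrow>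
        ((\<lambda>h. L (h * dx) (h * dy) (\<lambda>I. q (z + grid_point (h * dx) (h * dy) I)) (0, 0))
           \<longlongrightarrow> Jx *v qx z + Jy *v qy z) (at_right 0))"

definition semidiscrete_solution ::
  "('n grid_fun \<Rightarrow> 'n grid_fun) \<Rightarrow> (real \<Rightarrow> ('n::finite) grid_fun) \<Rightarrow> bool"
  where
  "semidiscrete_solution A Q \<longleftrightarrow>
     (\<forall>t I. ((\<lambda>s. Q s I) has_vector_derivative - A (Q t) I) (at t))"

definition numerical_stationary_state ::
  "('n grid_fun \<Rightarrow> 'n grid_fun) \<Rightarrow> ('n::finite) grid_fun \<Rightarrow> bool"
  where
  "numerical_stationary_state A q \<longleftrightarrow> semidiscrete_solution A (\<lambda>t. q)"

text \<open>
  Being free is a property of the whole collection \<open>X\<close> of stationary states: some component may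
  be prescribed as an arbitrary function of position. Freedom in a function of only one of the two
  coordinates (as for shear flows) does not count.
\<close>

definition nontrivial_states :: "('n::finite) grid_fun set \<Rightarrow> bool" where
  "nontrivial_states X \<longleftrightarrow> (\<exists>m. \<forall>f :: int \<times> int \<Rightarrow> real. \<exists>q\<in>X. \<forall>I. q I $ m = f I)"

text \<open>
  The grid functions \<open>Q h\<close> discretize \<open>q\<close> if they converge to it locally uniformly.
\<close>

definition discretizes ::
  "real \<Rightarrow> real \<Rightarrow> (real \<Rightarrow> ('n::finite) grid_fun) \<Rightarrow> (real \<times> real \<Rightarrow> real ^ 'n) \<Rightarrow> bool"
  where
  "discretizes dx dy Q q \<longleftrightarrow>
     (\<forall>r>0. \<forall>e>0. \<forall>\<^sub>F h in at_right 0. \<forall>I.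
        norm (grid_point (h * dx) (h * dy) I) \<le> r \<longrightarrow>
        norm (Q h I - q (grid_point (h * dx) (h * dy) I)) < e)"

definition stationarity_preserving ::
  "real ^ 'n ^ 'n \<Rightarrow> real ^ 'n ^ 'n \<Rightarrow> 'n scheme \<Rightarrow> real \<Rightarrow> real \<Rightarrow> bool"
  where
  "stationarity_preserving Jx Jy L dx dy \<longleftrightarrow>
     linear_scheme L \<and> consistent_scheme Jx Jy L dx dy \<and>
     nontrivial_states {q. numerical_stationary_state (L dx dy) q} \<and>
     (\<forall>q. analytic_stationary_state Jx Jy q \<longrightarrow>
        (\<exists>Q. (\<forall>h>0. numerical_stationary_state (L (h * dx) (h * dy)) (Q h)) \<and>
             discretizes dx dy Q q))"


text \<open>The acoustic equations, with \<open>q = (u, v, p)\<close>.\<close>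

definition J\<^sub>x :: "real \<Rightarrow> real \<Rightarrow> real ^ 3 ^ 3" where
  "J\<^sub>x c \<epsilon> = vector [vector [0, 0, 1 / \<epsilon>\<^sup>2], vector [0, 0, 0], vector [c\<^sup>2, 0, 0]]"

definition J\<^sub>y :: "real \<Rightarrow> real \<Rightarrow> real ^ 3 ^ 3" where
  "J\<^sub>y c \<epsilon> = vector [vector [0, 0, 0], vector [0, 0, 1 / \<epsilon>\<^sup>2], vector [0, c\<^sup>2, 0]]"

definition D\<^sub>x :: "real \<Rightarrow> real \<Rightarrow> real ^ 3 ^ 3" where
  "D\<^sub>x c \<epsilon> = vector [vector [c / \<epsilon>, 0, 0], vector [0, 0, 0], vector [0, 0, c / \<epsilon>]]"

definition D\<^sub>y :: "real \<Rightarrow> real \<Rightarrow> real ^ 3 ^ 3" where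
  "D\<^sub>y c \<epsilon> = vector [vector [0, 0, 0], vector [0, c / \<epsilon>, 0], vector [0, 0, c / \<epsilon>]]"

definition roe_scheme :: "real \<Rightarrow> real \<Rightarrow> 3 scheme" where
  "roe_scheme c \<epsilon> dx dy q = (\<lambda>(i, j).
     (1 / (2 * dx)) *\<^sub>R
       (J\<^sub>x c \<epsilon> *v (q (i + 1, j) - q (i - 1, j))
        - D\<^sub>x c \<epsilon> *v (q (i + 1, j) - 2 *\<^sub>R q (i, j) + q (i - 1, j))) +
     (1 / (2 * dy)) *\<^sub>R
       (J\<^sub>y c \<epsilon> *v (q (i, j + 1) - q (i, j - 1))
        - D\<^sub>y c \<epsilon> *v (q (i, j + 1) - 2 *\<^sub>R q (i, j) + q (i, j - 1))))"


lemma acoustic_equations: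
  "qt + J\<^sub>x c \<epsilon> *v qx + J\<^sub>y c \<epsilon> *v qy = 0 \<longleftrightarrow>
     qt $ 1 + 1 / \<epsilon>\<^sup>2 * qx $ 3 = 0 \<and> qt $ 2 + 1 / \<epsilon>\<^sup>2 * qy $ 3 = 0 \<and>
     qt $ 3 + c\<^sup>2 * (qx $ 1 + qy $ 2) = 0"
  by (simp add: vec_eq_iff forall_3 matrix_vector_mult_def sum_3 J\<^sub>x_def J\<^sub>y_def vector_3
      algebra_simps)

lemma analytic_stationary_state_acoustic:
  assumes "c > 0" "\<epsilon> > 0"
  shows "analytic_stationary_state (J\<^sub>x c \<epsilon>) (J\<^sub>y c \<epsilon>) q \<longleftrightarrow>
    (\<exists>qx qy. has_C1_partials q qx qy \<and>
       (\<forall>z. qx z $ 3 = 0 \<and> qy z $ 3 = 0 \<and> qx z $ 1 + qy z $ 2 = 0))"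
    (is "?L \<longleftrightarrow> ?R")
proof
  assume ?L
  then obtain qt qx qy where
    d: "\<And>t z. ((\<lambda>s. q z) has_vector_derivative qt t z) (at t)" and
    p: "\<And>t. has_C1_partials q (qx t) (qy t)" and
    e: "\<And>t z. qt t z + J\<^sub>x c \<epsilon> *v qx t z + J\<^sub>y c \<epsilon> *v qy t z = 0"
    unfolding analytic_stationary_state_def pde_solution_def by metis
  have "qt t z = 0" for t :: real and z
    using vector_derivative_unique_at[OF d[of z t] has_vector_derivative_const] .
  with e[of 0] assms p[of 0] show ?R
    unfolding acoustic_equations by (intro exI[of _ "qx 0"] exI[of _ "qy 0"]) auto
next
  assume ?R
  then obtain qx qy where
    p: "has_C1_partials q qx qy"
       "\<And>z. qx z $ 3 = 0 \<and> qy z $ 3 = 0 \<and> qx z $ 1 + qy z $ 2 = 0" by blast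
  have "0 + J\<^sub>x c \<epsilon> *v qx z + J\<^sub>y c \<epsilon> *v qy z = 0" for z
    unfolding acoustic_equations using p(2)[of z] by simp
  with p(1) show ?L
    unfolding analytic_stationary_state_def pde_solution_def
    by (intro exI[of _ "\<lambda>t z. 0"] exI[of _ "\<lambda>t. qx"] exI[of _ "\<lambda>t. qy"])
       auto
qed

lemma numerical_stationary_state_iff:
  "numerical_stationary_state A q \<longleftrightarrow> (\<forall>I. A q I = 0)"
proof -
  have "((\<lambda>s. q I) has_vector_derivative - A q I) (at t) \<longleftrightarrow> A q I = 0" for I and t :: real
    using vector_derivative_unique_at[OF _ has_vector_derivative_const[of "q I" "at t"]]
    by fastforce
  then show ?thesis
    by (simp add: numerical_stationary_state_def semidiscrete_solution_def)
qed


text \<open>The absolute value of a diagonalizable matrix, defined on the eigenvalues.\<close>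

definition diagonal_matrix :: "('n::finite \<Rightarrow> real) \<Rightarrow> real ^ 'n ^ 'n" where
  "diagonal_matrix l = (\<chi> i j. if i = j then l i else 0)"

definition is_matrix_abs :: "real ^ 'n ^ 'n \<Rightarrow> real ^ 'n ^ 'n \<Rightarrow> bool" where
  "is_matrix_abs J D \<longleftrightarrow>
     (\<exists>(R :: real ^ 'n ^ 'n) R' l. R ** R' = mat 1 \<and> R' ** R = mat 1 \<and>
        J = R ** diagonal_matrix l ** R' \<and>
        D = R ** diagonal_matrix (\<lambda>i. \<bar>l i\<bar>) ** R')"

lemma is_matrix_absI:
  fixes R :: "real ^ 'n ^ 'n"
  assumes "det R \<noteq> 0" "J ** R = R ** diagonal_matrix l"
    "D ** R = R ** diagonal_matrix (\<lambda>i. \<bar>l i\<bar>)"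
  shows "is_matrix_abs J D"
proof -
  obtain R' where R: "R ** R' = mat 1" "R' ** R = mat 1"
    using assms(1) by (auto simp: invertible_det_nz[symmetric] invertible_def)
  have "A = B ** R'" if "A ** R = B" for A B :: "real ^ 'n ^ 'n"
    using that R by (metis matrix_mul_assoc matrix_mul_rid)
  with assms R show ?thesis unfolding is_matrix_abs_def by blast
qed

lemma D\<^sub>x_eq_abs_J\<^sub>x:
  assumes "c > 0" "\<epsilon> > 0"
  shows "is_matrix_abs (J\<^sub>x c \<epsilon>) (D\<^sub>x c \<epsilon>)"
proof (rule is_matrix_absI)
  let ?R = "vector [vector [1, 0, 1], vector [0, 1, 0], vector [c * \<epsilon>, 0, - c * \<epsilon>]] :: real^3^3"
  let ?l = "\<lambda>i::3. if i = 1 then c / \<epsilon> else if i = 2 then 0 else - c / \<epsilon>"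
  show "det ?R \<noteq> 0" using assms by (simp add: det_3 vector_3)
  show "J\<^sub>x c \<epsilon> ** ?R = ?R ** diagonal_matrix ?l"
    "D\<^sub>x c \<epsilon> ** ?R = ?R ** diagonal_matrix (\<lambda>i. \<bar>?l i\<bar>)"
    using assms
    by (simp_all add: vec_eq_iff forall_3 matrix_matrix_mult_def sum_3 vector_3 J\<^sub>x_def D\<^sub>x_def
        diagonal_matrix_def field_simps power2_eq_square)
qed

lemma D\<^sub>y_eq_abs_J\<^sub>y:
  assumes "c > 0" "\<epsilon> > 0"
  shows "is_matrix_abs (J\<^sub>y c \<epsilon>) (D\<^sub>y c \<epsilon>)"
proof (rule is_matrix_absI)
  let ?R = "vector [vector [1, 0, 0], vector [0, 1, 1], vector [0, c * \<epsilon>, - c * \<epsilon>]] :: real^3^3"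
  let ?l = "\<lambda>i::3. if i = 1 then 0 else if i = 2 then c / \<epsilon> else - c / \<epsilon>"
  show "det ?R \<noteq> 0" using assms by (simp add: det_3 vector_3)
  show "J\<^sub>y c \<epsilon> ** ?R = ?R ** diagonal_matrix ?l"
    "D\<^sub>y c \<epsilon> ** ?R = ?R ** diagonal_matrix (\<lambda>i. \<bar>?l i\<bar>)"
    using assms
    by (simp_all add: vec_eq_iff forall_3 matrix_matrix_mult_def sum_3 vector_3 J\<^sub>y_def D\<^sub>y_def
        diagonal_matrix_def field_simps power2_eq_square)
qed


text \<open>The Roe scheme is a consistent linear scheme.\<close>

lemma roe_linear: "linear_scheme (roe_scheme c \<epsilon>)"
  unfolding linear_scheme_def
proof (intro allI impI)
  fix dx dy :: real
  let ?S = "{(0,0), (1,0), (-1,0), (0,1), (0,-1)} :: (int \<times> int) set"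
  let ?a = "\<lambda>S :: int \<times> int.
    if S = (0,0) then (1 / dx) *\<^sub>R D\<^sub>x c \<epsilon> + (1 / dy) *\<^sub>R D\<^sub>y c \<epsilon>
    else if S = (1,0) then (1 / (2 * dx)) *\<^sub>R (J\<^sub>x c \<epsilon> - D\<^sub>x c \<epsilon>)
    else if S = (-1,0) then - ((1 / (2 * dx)) *\<^sub>R (J\<^sub>x c \<epsilon> + D\<^sub>x c \<epsilon>))
    else if S = (0,1) then (1 / (2 * dy)) *\<^sub>R (J\<^sub>y c \<epsilon> - D\<^sub>y c \<epsilon>)
    else - ((1 / (2 * dy)) *\<^sub>R (J\<^sub>y c \<epsilon> + D\<^sub>y c \<epsilon>))"
  have m: "(- A) *v x = - (A *v x)" for A :: "real^3^3" and x
    by (simp add: vec_eq_iff matrix_vector_mult_def sum_negf)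
  have "roe_scheme c \<epsilon> dx dy q I = (\<Sum>S\<in>?S. ?a S *v q (I + S))" for q I
    by (cases I) (simp add: roe_scheme_def m matrix_vector_right_distrib
        matrix_vector_mult_diff_distrib matrix_vector_mult_scaleR matrix_vector_mult_add_rdistrib
        matrix_vector_mult_diff_rdistrib scaleR_add_right scaleR_diff_right
        flip: scaleR_matrix_vector_assoc)
  then show "\<exists>\<S> \<alpha>. finite \<S> \<and> (\<forall>q I. roe_scheme c \<epsilon> dx dy q I = (\<Sum>S\<in>\<S>. \<alpha> S *v q (I + S)))"
    by (intro exI[of _ ?S] exI[of _ ?a]) simp
qed

lemma symmetric_difference_limits:
  fixes g :: "real \<Rightarrow> 'a::real_normed_vector"
  assumes "(g has_vector_derivative D) (at 0)" "d > 0"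
  shows "((\<lambda>h. (1 / (2 * (h * d))) *\<^sub>R (g (h * d) - g (- (h * d)))) \<longlongrightarrow> D) (at_right 0)"
    and "((\<lambda>h. (1 / (2 * (h * d))) *\<^sub>R (g (h * d) - 2 *\<^sub>R g 0 + g (- (h * d)))) \<longlongrightarrow> 0) (at_right 0)"
proof -
  have lim: "((\<lambda>s. (1 / s) *\<^sub>R (g s - g 0)) \<longlongrightarrow> D) (at 0)"
  proof -
    have "((\<lambda>s. ((g s - g 0) - s *\<^sub>R D) /\<^sub>R norm s) \<longlongrightarrow> 0) (at 0)"
      using assms(1) by (auto simp: has_vector_derivative_def has_derivative_at_within)
    then have "((\<lambda>s. norm (((g s - g 0) - s *\<^sub>R D) /\<^sub>R norm s)) \<longlongrightarrow> 0) (at 0)"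
      by (rule tendsto_norm_zero)
    then have "((\<lambda>s. norm ((1 / s) *\<^sub>R (g s - g 0) - D)) \<longlongrightarrow> 0) (at 0)"
    proof (rule Lim_transform_eventually)
      have "norm (((g s - g 0) - s *\<^sub>R D) /\<^sub>R norm s) = norm ((1 / s) *\<^sub>R (g s - g 0) - D)"
        if "s \<noteq> 0" for s
      proof -
        have "(1 / s) *\<^sub>R (g s - g 0) - D = (1 / s) *\<^sub>R ((g s - g 0) - s *\<^sub>R D)"
          using that by (simp add: algebra_simps)
        then show ?thesis by (simp add: divide_inverse)
      qed
      then show "\<forall>\<^sub>F s in at 0. norm (((g s - g 0) - s *\<^sub>R D) /\<^sub>R norm s)
          = norm ((1 / s) *\<^sub>R (g s - g 0) - D)"
        by (auto simp: eventually_at_filter)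
    qed
    then show ?thesis by (rule LIM_zero_cancel[OF tendsto_norm_zero_cancel])
  qed
  have f1: "filterlim (\<lambda>h. h * d) (at 0) (at_right 0)"
    and f2: "filterlim (\<lambda>h. - (h * d)) (at 0) (at_right 0)"
    using assms(2) by (auto simp: filterlim_at eventually_at_filter intro!: tendsto_eq_intros)
  note 1 = filterlim_compose[OF lim f1]
  note 2 = filterlim_compose[OF lim f2]
  have 3: "(1 / 2) *\<^sub>R ((1 / a) *\<^sub>R (x - w) + (1 / (- a)) *\<^sub>R (y - w)) = (1 / (2 * a)) *\<^sub>R (x - y)"
    and 4: "(1 / 2) *\<^sub>R ((1 / a) *\<^sub>R (x - w) - (1 / (- a)) *\<^sub>R (y - w))
      = (1 / (2 * a)) *\<^sub>R (x - 2 *\<^sub>R w + y)"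
    for a :: real and x y w :: 'a
  proof -
    have "x - 2 *\<^sub>R w + y = (x - w) + (y - w)" by (simp add: scaleR_2)
    then show "(1 / 2) *\<^sub>R ((1 / a) *\<^sub>R (x - w) - (1 / (- a)) *\<^sub>R (y - w))
      = (1 / (2 * a)) *\<^sub>R (x - 2 *\<^sub>R w + y)"
      by (simp only:) (simp add: scaleR_add_right)
  qed (simp add: scaleR_add_right scaleR_diff_right)
  from tendsto_scaleR[OF tendsto_const[of "1/2"] tendsto_add[OF 1 2]]
  show "((\<lambda>h. (1 / (2 * (h * d))) *\<^sub>R (g (h * d) - g (- (h * d)))) \<longlongrightarrow> D) (at_right 0)"
    unfolding 3 by (simp flip: scaleR_2)
  from tendsto_scaleR[OF tendsto_const[of "1/2"] tendsto_diff[OF 1 2]]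
  show "((\<lambda>h. (1 / (2 * (h * d))) *\<^sub>R (g (h * d) - 2 *\<^sub>R g 0 + g (- (h * d)))) \<longlongrightarrow> 0) (at_right 0)"
    unfolding 4 by simp
qed

lemma roe_consistent:
  assumes "dx > 0" "dy > 0"
  shows "consistent_scheme (J\<^sub>x c \<epsilon>) (J\<^sub>y c \<epsilon>) (roe_scheme c \<epsilon>) dx dy"
  unfolding consistent_scheme_def
proof (intro allI impI)
  fix q qx qy :: "real \<times> real \<Rightarrow> real ^ 3" and z
  assume "has_C1_partials q qx qy"
  then have q: "(q has_derivative (\<lambda>d. fst d *\<^sub>R qx z + snd d *\<^sub>R qy z)) (at z)"
    unfolding has_C1_partials_def by blast
  then have q0: "(q has_derivative (\<lambda>d. fst d *\<^sub>R qx z + snd d *\<^sub>R qy z)) (at (z + (0, 0)))"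
    by (simp flip: zero_prod_def)
  have gx: "((\<lambda>s. q (z + (s, 0))) has_vector_derivative qx z) (at 0)"
  proof -
    have "((\<lambda>s. z + (s, 0)) has_derivative (\<lambda>s. (s, 0))) (at 0)"
      by (auto intro!: derivative_eq_intros)
    from has_derivative_compose[OF this q0] show ?thesis
      by (simp add: has_vector_derivative_def)
  qed
  have gy: "((\<lambda>s. q (z + (0, s))) has_vector_derivative qy z) (at 0)"
  proof -
    have "((\<lambda>s. z + (0, s)) has_derivative (\<lambda>s. (0, s))) (at 0)"
      by (auto intro!: derivative_eq_intros)
    from has_derivative_compose[OF this q0] show ?thesis
      by (simp add: has_vector_derivative_def)
  qed
  note X = symmetric_difference_limits[OF gx assms(1)]
  note Y = symmetric_difference_limits[OF gy assms(2)]
  note mv = bounded_linear.tendsto[OF matrix_vector_mul_bounded_linear]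
  have "((\<lambda>h. roe_scheme c \<epsilon> (h * dx) (h * dy) (\<lambda>I. q (z + grid_point (h * dx) (h * dy) I)) (0, 0))
     \<longlongrightarrow> (J\<^sub>x c \<epsilon> *v qx z - D\<^sub>x c \<epsilon> *v 0) + (J\<^sub>y c \<epsilon> *v qy z - D\<^sub>y c \<epsilon> *v 0)) (at_right 0)"
    using tendsto_add[OF tendsto_diff[OF mv[OF X(1)] mv[OF X(2)]]
        tendsto_diff[OF mv[OF Y(1)] mv[OF Y(2)]], of "J\<^sub>x c \<epsilon>" "D\<^sub>x c \<epsilon>" "J\<^sub>y c \<epsilon>" "D\<^sub>y c \<epsilon>"]
    by (simp add: roe_scheme_def grid_point_def matrix_vector_mult_scaleR
        matrix_vector_mult_diff_distrib matrix_vector_right_distrib scaleR_diff_right scaleR_add_right)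
  then show "((\<lambda>h. roe_scheme c \<epsilon> (h * dx) (h * dy) (\<lambda>I. q (z + grid_point (h * dx) (h * dy) I)) (0, 0))
     \<longlongrightarrow> J\<^sub>x c \<epsilon> *v qx z + J\<^sub>y c \<epsilon> *v qy z) (at_right 0)"
    by simp
qed

end

theory Submission
  imports Defs
begin

text \<open>
  The scheme has no nontrivial stationary states: no component of a numerical stationary state is
  free. Up to the constant \<open>c * \<epsilon>\<close>, which is absorbed into the velocities as \<open>U = c * \<epsilon> * u\<close>
  and \<open>V = c * \<epsilon> * v\<close>, the momentum equations of the stationary scheme say that the centred difference of the pressure in each
  direction is the second difference of the velocity in that direction. Writing \<open>T\<close> for the shift
  by one cell, the identity
  \<open>(T - T\<^sup>-\<^sup>1)\<^sup>2 - (T - 2 + T\<^sup>-\<^sup>1)\<^sup>2 = 4 (T - 2 + T\<^sup>-\<^sup>1)\<close>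
  therefore eliminates both velocities from the pressure equation: applying the second differences
  in \<open>x\<close> and in \<open>y\<close> to it leaves
  \<open>4 (1 / (2 dx) + 1 / (2 dy)) \<delta>\<^sub>x\<delta>\<^sub>y p = 0\<close>, where \<open>\<delta>\<close> denotes a second difference
  (lemma \<open>pressure_constraint\<close>). Hence the pressure is constrained, and taking a centred difference
  once more carries the constraint over to each velocity: \<open>\<delta>\<^sub>x\<delta>\<^sub>y\<delta>\<^sub>x U = 0\<close> and
  \<open>\<delta>\<^sub>x\<delta>\<^sub>y\<delta>\<^sub>y V = 0\<close> (lemma \<open>velocity_constraint\<close>).

  The checkerboard grid function is an eigenfunction of both second differences with eigenvalue
  \<open>-4\<close>, so it violates all three constraints at once, and none of \<open>u\<close>, \<open>v\<close>, \<open>p\<close> can be prescribed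
  to be the checkerboard. The checkerboard is the Fourier mode with \<open>t\<^sub>x = t\<^sub>y = -1\<close>;
  there the centred differences vanish, only the numerical diffusion contributes to the evolution
  matrix, and its determinant is nonzero.
\<close>

definition centred_diff ::
  "'a::ab_group_add \<Rightarrow> ('a \<Rightarrow> real) \<Rightarrow> 'a \<Rightarrow> real" where
  "centred_diff e f I = f (I + e) - f (I - e)"

definition second_diff ::
  "'a::ab_group_add \<Rightarrow> ('a \<Rightarrow> real) \<Rightarrow> 'a \<Rightarrow> real" where
  "second_diff e f I = f (I + e) - 2 * f I + f (I - e)"

lemma second_diff_commute:
  "second_diff a (second_diff b f) = second_diff b (second_diff a f)"
  by (simp add: fun_eq_iff second_diff_def algebra_simps)

lemma second_diff_centred_diff_commute:
  "second_diff a (centred_diff b f) = centred_diff b (second_diff a f)"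
  by (simp add: fun_eq_iff second_diff_def centred_diff_def algebra_simps)

lemma second_diff_linear:
  "second_diff e (\<lambda>I. r * f I + s * g I) = (\<lambda>I. r * second_diff e f I + s * second_diff e g I)"
  by (simp add: fun_eq_iff second_diff_def algebra_simps)

lemma second_diff_cmult: "second_diff e (\<lambda>I. r * f I) = (\<lambda>I. r * second_diff e f I)"
  by (simp add: fun_eq_iff second_diff_def algebra_simps)

lemma centred_squared_minus_second_squared:
  "centred_diff e (centred_diff e f) I - second_diff e (second_diff e f) I = 4 * second_diff e f I"
  by (simp add: centred_diff_def second_diff_def algebra_simps)

text \<open>
  The argument of the outer second difference is the contribution of one direction to the pressure
  equation. The momentum equation turns its first term into an iterated centred difference of
  \<open>p\<close>, which the numerical diffusion in its second term then cancels up to \<open>4 \<delta> p\<close>.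
\<close>

lemma second_diff_upwind_divergence:
  assumes "centred_diff e p = second_diff e U"
  shows "second_diff e (\<lambda>I. centred_diff e U I - second_diff e p I) = (\<lambda>I. 4 * second_diff e p I)"
proof
  fix I
  have "second_diff e (\<lambda>I. centred_diff e U I - second_diff e p I) I =
      second_diff e (centred_diff e U) I - second_diff e (second_diff e p) I"
    by (simp add: second_diff_def)
  also have "second_diff e (centred_diff e U) = centred_diff e (centred_diff e p)"
    by (simp add: assms second_diff_centred_diff_commute)
  finally show "second_diff e (\<lambda>I. centred_diff e U I - second_diff e p I) I = 4 * second_diff e p I"
    by (simp add: centred_squared_minus_second_squared)
qed

text \<open>
  Both directions leave the same multiple of the same mixed difference of \<open>p\<close>, each because the
  second difference in the other direction commutes with everything in it. Nothing cancels since
  the two weights have the same sign.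
\<close>

lemma pressure_constraint:
  assumes x: "centred_diff a p = second_diff a U"
    and y: "centred_diff b p = second_diff b V"
    and div: "\<And>I. r * (centred_diff a U I - second_diff a p I)
      + s * (centred_diff b V I - second_diff b p I) = 0"
    and "r > 0" "s > 0"
  shows "second_diff a (second_diff b p) = (\<lambda>I. 0)"
proof
  fix I
  let ?X = "\<lambda>I. centred_diff a U I - second_diff a p I"
  let ?Y = "\<lambda>I. centred_diff b V I - second_diff b p I"
  have "second_diff a (second_diff b (\<lambda>I. r * ?X I + s * ?Y I)) I = 0"
    unfolding div by (simp add: second_diff_def)
  moreover have "second_diff a (second_diff b (\<lambda>I. r * ?X I + s * ?Y I)) I =
      r * second_diff b (second_diff a ?X) I + s * second_diff a (second_diff b ?Y) I"
    by (simp only: second_diff_linear second_diff_commute[of a b ?X])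
  moreover have "\<dots> = 4 * (r + s) * second_diff a (second_diff b p) I"
    unfolding second_diff_upwind_divergence[OF x] second_diff_upwind_divergence[OF y]
      second_diff_cmult second_diff_commute[of b a]
    by (simp add: algebra_simps)
  ultimately show "second_diff a (second_diff b p) I = 0"
    using \<open>r > 0\<close> \<open>s > 0\<close> by simp
qed

lemma velocity_constraint:
  assumes "second_diff a (second_diff b p) = (\<lambda>I. 0)" "centred_diff e p = second_diff e U"
  shows "second_diff a (second_diff b (second_diff e U)) = (\<lambda>I. 0)"
proof -
  have "second_diff a (second_diff b (second_diff e U)) = centred_diff e (\<lambda>I. 0)"
    by (simp flip: assms add: second_diff_centred_diff_commute)
  then show ?thesis by (simp add: centred_diff_def fun_eq_iff)
qed

text \<open>
  The factor \<open>c * \<epsilon>\<close> is the ratio of the entries of \<open>D\<^sub>x\<close> and \<open>J\<^sub>x\<close> in the momentum equations, and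
  also that of the entries of \<open>J\<^sub>x\<close> and \<open>D\<^sub>x\<close> in the pressure equation. Hence scaling the velocities
  by it removes the physical constants from all three equations, which leaves the form that
  \<open>pressure_constraint\<close> takes.
\<close>

lemma roe_stationary_equations:
  fixes q :: "3 grid_fun"
  assumes pos: "c > 0" "\<epsilon> > 0" "dx > 0" "dy > 0"
    and stat: "numerical_stationary_state (roe_scheme c \<epsilon> dx dy) q"
  defines "U \<equiv> \<lambda>I. c * \<epsilon> * q I $ 1" and "V \<equiv> \<lambda>I. c * \<epsilon> * q I $ 2" and "p \<equiv> \<lambda>I. q I $ 3"
  shows "centred_diff (1, 0) p = second_diff (1, 0) U"
    and "centred_diff (0, 1) p = second_diff (0, 1) V"
    and "1 / (2 * dx) * (centred_diff (1, 0) U I - second_diff (1, 0) p I)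
      + 1 / (2 * dy) * (centred_diff (0, 1) V I - second_diff (0, 1) p I) = 0"
proof -
  have roe: "roe_scheme c \<epsilon> dx dy q I = 0" for I
    using stat unfolding numerical_stationary_state_iff by blast
  have components: "roe_scheme c \<epsilon> dx dy q I $ 1
      = 1 / (2 * dx * \<epsilon>\<^sup>2) * (centred_diff (1, 0) p I - second_diff (1, 0) U I)"
    "roe_scheme c \<epsilon> dx dy q I $ 2
      = 1 / (2 * dy * \<epsilon>\<^sup>2) * (centred_diff (0, 1) p I - second_diff (0, 1) V I)"
    "roe_scheme c \<epsilon> dx dy q I $ 3
      = c / \<epsilon> * (1 / (2 * dx) * (centred_diff (1, 0) U I - second_diff (1, 0) p I)
        + 1 / (2 * dy) * (centred_diff (0, 1) V I - second_diff (0, 1) p I))" for I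
    using pos
    by (cases I; simp add: roe_scheme_def matrix_vector_mult_def sum_3 vector_3
        J\<^sub>x_def J\<^sub>y_def D\<^sub>x_def D\<^sub>y_def centred_diff_def second_diff_def U_def V_def p_def
        field_simps power2_eq_square)+
  show "centred_diff (1, 0) p = second_diff (1, 0) U"
    and "centred_diff (0, 1) p = second_diff (0, 1) V"
    using components(1,2) pos by (simp_all add: roe fun_eq_iff)
  show "1 / (2 * dx) * (centred_diff (1, 0) U I - second_diff (1, 0) p I)
      + 1 / (2 * dy) * (centred_diff (0, 1) V I - second_diff (0, 1) p I) = 0"
    using components(3)[of I] pos unfolding roe by simp
qed

definition checkerboard :: "int \<times> int \<Rightarrow> real" where
  "checkerboard I = (if even (fst I + snd I) then 1 else - 1)"

lemma second_diff_checkerboard: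
  assumes "odd (fst e + snd e)"
  shows "second_diff e checkerboard = (\<lambda>I. - 4 * checkerboard I)"
  using assms by (auto simp: fun_eq_iff second_diff_def checkerboard_def)

lemma roe_not_nontrivial:
  assumes pos: "c > 0" "\<epsilon> > 0" "dx > 0" "dy > 0"
  shows "\<not> nontrivial_states {q. numerical_stationary_state (roe_scheme c \<epsilon> dx dy) q}"
proof
  assume "nontrivial_states {q. numerical_stationary_state (roe_scheme c \<epsilon> dx dy) q}"
  then obtain m q where
    stat: "numerical_stationary_state (roe_scheme c \<epsilon> dx dy) q" and
    free: "\<And>I. q I $ m = checkerboard I"
    unfolding nontrivial_states_def by blast
  note eqs = roe_stationary_equations[OF pos stat]
  have p: "second_diff (1, 0) (second_diff (0, 1) (\<lambda>I. q I $ 3)) = (\<lambda>I. 0)"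
    by (rule pressure_constraint[OF eqs]) (use pos in simp_all)
  note u = velocity_constraint[OF p eqs(1)] and v = velocity_constraint[OF p eqs(2)]
  have cb: "second_diff (1, 0) checkerboard = (\<lambda>I. - 4 * checkerboard I)"
    "second_diff (0, 1) checkerboard = (\<lambda>I. - 4 * checkerboard I)"
    by (simp_all add: second_diff_checkerboard)
  have nz: "checkerboard (0, 0) \<noteq> 0" by (simp add: checkerboard_def)
  consider "m = 1" | "m = 2" | "m = 3" using exhaust_3[of m] by blast
  then show False
  proof cases
    case 1
    then show False using fun_cong[OF u, of "(0, 0)"] free pos nz
      by (simp only: second_diff_cmult cb) simp
  next
    case 2
    then show False using fun_cong[OF v, of "(0, 0)"] free pos nz
      by (simp only: second_diff_cmult cb) simp
  next
    case 3
    then show False using fun_cong[OF p, of "(0, 0)"] free nz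
      by (simp only: second_diff_cmult cb)
  qed
qed

theorem corollary5:
  fixes c \<epsilon> dx dy :: real
  assumes "c > 0" and "\<epsilon> > 0" and "dx > 0" and "dy > 0"
  shows "\<not> stationarity_preserving (J\<^sub>x c \<epsilon>) (J\<^sub>y c \<epsilon>) (roe_scheme c \<epsilon>) dx dy"
  using roe_not_nontrivial[OF assms] unfolding stationarity_preserving_def by blast

end
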